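(* Let $D\subsetneq\mathbb{C}$ be a simply connected domain and $(\phi_t^D)_{t\ge0}$ a continuous one-parameter semigroup of holomorphic functions in $D$. (a) If $(\phi_t^D)$ is elliptic, then every forward orbit of $(\phi_t^D)$ is Lipschitz. (b) If $(\phi_t^D)$ is non-elliptic and the impression of the Denjoy-Wolff prime end of $(\phi_t^D)$ does not contain $\infty$, then every forward orbit of $(\phi_t^D)$ is Lipschitz.
   Context: A (continuous one-parameter) semigroup in a simply connected domain $D\subsetneq\mathbb{C}$ is a family $(\phi_t^D)_{t\ge0}$ of holomorphic functions $\phi_t^D:D\to D$ such that $\phi_0^D=\mathrm{id}_D$, $\phi_{t+s}^D=\phi_t^D\circ\phi_s^D$ for all $t,s\ge0$, and $\phi_t^D\to\phi_0^D$ locally uniformly in $D$ as $t\to0^+$. Given a Riemann map $f:\mathbb{D}\to D$, one has $\phi_t^D=f\circ\phi_t\circ f^{-1}$ for a semigroup $(\phi_t)$ in $\mathbb{D}$. If $(\phi_t)$ is not a group of hyperbolic rotations (including the trivial semigroup), there is a unique $\tau\in\overline{\mathbb{D}}$ (Denjoy-Wolff point) with $\phi_t(z)\to\tau$ as $t\to+\infty$ for all $z\in\mathbb{D}$. $(\phi_t^D)$ is elliptic if $\tau\in\mathbb{D}$ (then $f(\tau)\in D$ is its Denjoy-Wolff point), and non-elliptic if $\tau\in\partial\mathbb{D}$. In the non-elliptic case the Denjoy-Wolff prime end of $(\phi_t^D)$ is the prime end $\xi$ of $D$ corresponding to $\tau$ under $f$ (Carathéodory's theorem). Its impression is the set of all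 limits in the Riemann sphere of sequences $f(z_n)$ with $z_n\in\mathbb{D}$, $z_n\to\tau$. For $\zeta\in D$ the forward orbit is $\gamma_\zeta^D:[0,+\infty)\to D$, $\gamma_\zeta^D(t)=\phi_t^D(\zeta)$. A function $\gamma:I\to\mathbb{C}$ on an interval $I\subset\mathbb{R}$ is Lipschitz if there is $C>0$ with $|\gamma(t)-\gamma(s)|\le C|t-s|$ for all $t,s\in I$ (Euclidean distance). *)

theory Defs
  imports "HOL-Complex_Analysis.Complex_Analysis"
begin

text \<open>Only the values of \<open>\<phi> t z\<close> with \<open>t \<ge> 0\<close> and \<open>z \<in> D\<close> are meaningful. Since \<open>D\<close> will be open in
  the plane, locally uniform convergence in \<open>D\<close> is uniform convergence on its compact subsets.\<close>

definition holomorphic_semigroup :: "complex set \<Rightarrow> (real \<Rightarrow> complex \<Rightarrow> complex) \<Rightarrow> bool" where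
  "holomorphic_semigroup D \<phi> \<longleftrightarrow>
     (\<forall>t\<ge>0. \<phi> t holomorphic_on D \<and> \<phi> t ` D \<subseteq> D) \<and>
     (\<forall>z\<in>D. \<phi> 0 z = z) \<and>
     (\<forall>t\<ge>0. \<forall>s\<ge>0. \<forall>z\<in>D. \<phi> (t + s) z = \<phi> t (\<phi> s z)) \<and>
     (\<forall>K. compact K \<and> K \<subseteq> D \<longrightarrow> uniform_limit K \<phi> (\<phi> 0) (at_right 0))"

definition riemann_map :: "(complex \<Rightarrow> complex) \<Rightarrow> complex set \<Rightarrow> bool" where
  "riemann_map f D \<longleftrightarrow> f holomorphic_on ball 0 1 \<and> bij_betw f (ball 0 1) D"

text \<open>The semigroup of the unit disc that \<open>f\<close> conjugates to \<open>\<phi>\<close>.\<close>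

definition disc_semigroup ::
    "(complex \<Rightarrow> complex) \<Rightarrow> (real \<Rightarrow> complex \<Rightarrow> complex) \<Rightarrow> real \<Rightarrow> complex \<Rightarrow> complex" where
  "disc_semigroup f \<phi> t z = inv_into (ball 0 1) f (\<phi> t (f z))"

text \<open>There is no such point when \<open>\<psi>\<close> is a group of hyperbolic rotations of the disc, trivial or not,
  because the orbits then have no common limit. Hence these groups are neither elliptic nor
  non-elliptic in the sense below.\<close>

definition denjoy_wolff_point :: "(real \<Rightarrow> complex \<Rightarrow> complex) \<Rightarrow> complex \<Rightarrow> bool" where
  "denjoy_wolff_point \<psi> \<tau> \<longleftrightarrow>
     \<tau> \<in> cball 0 1 \<and> (\<forall>z\<in>ball 0 1. ((\<lambda>t. \<psi> t z) \<longlongrightarrow> \<tau>) at_top)"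

definition elliptic :: "(complex \<Rightarrow> complex) \<Rightarrow> (real \<Rightarrow> complex \<Rightarrow> complex) \<Rightarrow> bool" where
  "elliptic f \<phi> \<longleftrightarrow> (\<exists>\<tau>\<in>ball 0 1. denjoy_wolff_point (disc_semigroup f \<phi>) \<tau>)"

definition non_elliptic :: "(complex \<Rightarrow> complex) \<Rightarrow> (real \<Rightarrow> complex \<Rightarrow> complex) \<Rightarrow> bool" where
  "non_elliptic f \<phi> \<longleftrightarrow> (\<exists>\<tau>\<in>sphere 0 1. denjoy_wolff_point (disc_semigroup f \<phi>) \<tau>)"

text \<open>The point \<open>None\<close> of the one-point compactification is the point at infinity.\<close>

definition riemann_sphere :: "complex option topology" where
  "riemann_sphere = Alexandroff_compactification euclidean"

text \<open>The impression of the prime end of \<open>f ` ball 0 1\<close> that corresponds under \<open>f\<close> to the boundary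
  point \<open>\<tau>\<close> of the disc.\<close>

definition impression :: "(complex \<Rightarrow> complex) \<Rightarrow> complex \<Rightarrow> complex option set" where
  "impression f \<tau> = {w. \<exists>z :: nat \<Rightarrow> complex. range z \<subseteq> ball 0 1 \<and> z \<longlonglongrightarrow> \<tau> \<and>
     limitin riemann_sphere (\<lambda>n. Some (f (z n))) w sequentially}"

text \<open>The union is over at most one \<open>\<tau>\<close>, as the Denjoy-Wolff point is unique.\<close>

definition denjoy_wolff_impression ::
    "(complex \<Rightarrow> complex) \<Rightarrow> (real \<Rightarrow> complex \<Rightarrow> complex) \<Rightarrow> complex option set" where
  "denjoy_wolff_impression f \<phi> =
     (\<Union>\<tau> \<in> {\<tau> \<in> sphere 0 1. denjoy_wolff_point (disc_semigroup f \<phi>) \<tau>}. impression f \<tau>)"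

definition forward_orbit :: "(real \<Rightarrow> complex \<Rightarrow> complex) \<Rightarrow> complex \<Rightarrow> real \<Rightarrow> complex" where
  "forward_orbit \<phi> \<zeta> t = \<phi> t \<zeta>"

definition lipschitz :: "real set \<Rightarrow> (real \<Rightarrow> complex) \<Rightarrow> bool" where
  "lipschitz I \<gamma> \<longleftrightarrow> (\<exists>C>0. C-lipschitz_on I \<gamma>)"

end

theory Submission
  imports Defs
begin

text \<open>Fix \<open>p \<notin> D\<close> and let \<open>h\<close> be a holomorphic branch of \<open>log (w - p)\<close> on \<open>D\<close>. As \<open>h ` D\<close> never contains
  both \<open>b\<close> and \<open>b + 2 \<pi> i\<close>, it contains no disc of radius greater than \<open>2 \<pi>\<close>, so Bloch's theorem bounds the
  derivatives of all the maps \<open>h \<circ> \<phi> t\<close> near \<open>\<zeta>\<close> by one constant. Together with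
  \<open>\<phi> s \<zeta> - \<zeta> = O(s)\<close> this makes \<open>h\<close> Lipschitz along the orbit, so the speed of the orbit at
  \<open>w\<close> is \<open>O(\<bar>w - p\<bar>)\<close> and every bounded orbit is Lipschitz. An orbit that tends to a point of \<open>D\<close> is
  bounded, and an unbounded orbit puts \<open>\<infinity>\<close> into the impression.\<close>

section \<open>Displacement of a point at small times\<close>

text \<open>Cauchy's inequality turns uniform smallness of the displacement
  \<open>\<phi> s z - z\<close> on a disc into smallness of its derivative on a concentric smaller
  disc, so nearby points are displaced almost equally.\<close>

lemma semigroup_near_identity:
  assumes "open D" "holomorphic_semigroup D \<phi>" "\<zeta> \<in> D"
  obtains r a where "r > 0" "a > 0"
    "\<And>s. 0 \<le> s \<Longrightarrow> s \<le> a \<Longrightarrow> \<phi> s \<zeta> \<in> ball \<zeta> r"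
    "\<And>s z w. 0 \<le> s \<Longrightarrow> s \<le> a \<Longrightarrow> z \<in> ball \<zeta> r \<Longrightarrow> w \<in> ball \<zeta> r \<Longrightarrow>
       norm ((\<phi> s z - z) - (\<phi> s w - w)) \<le> norm (z - w) / 2"
proof -
  have hol: "\<And>t. 0 \<le> t \<Longrightarrow> \<phi> t holomorphic_on D" and id: "\<And>z. z \<in> D \<Longrightarrow> \<phi> 0 z = z"
    and lim: "\<And>K. compact K \<Longrightarrow> K \<subseteq> D \<Longrightarrow> uniform_limit K \<phi> (\<phi> 0) (at_right 0)"
    using assms(2) by (auto simp: holomorphic_semigroup_def)
  obtain e where e: "e > 0" "cball \<zeta> e \<subseteq> D"
    using assms by (meson open_contains_cball)
  \<comment> \<open>Halving leaves room for Cauchy discs of radius \<open>r\<close> around every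
    point of \<open>ball \<zeta> r\<close>.\<close>
  define r where "r = e / 2"
  have r: "r > 0" "cball \<zeta> (2 * r) \<subseteq> D" using e by (auto simp: r_def)
  have sub: "ball \<zeta> r \<subseteq> D"
    using r by (intro order_trans[OF _ r(2)]) (auto simp: subset_iff)
  \<comment> \<open>Cauchy's inequality on discs of radius \<open>r\<close> will turn the bound
    \<open>r / 2\<close> into the derivative bound \<open>1 / 2\<close>.\<close>
  have "\<forall>\<^sub>F s in at_right 0. \<forall>x\<in>cball \<zeta> (2 * r). dist (\<phi> s x) (\<phi> 0 x) < r / 2"
    using lim[OF compact_cball r(2)] half_gt_zero[OF r(1)] unfolding uniform_limit_iff by blast
  then obtain b where b: "b > 0"
      "\<And>s. 0 < s \<Longrightarrow> s < b \<Longrightarrow> \<forall>x\<in>cball \<zeta> (2 * r). dist (\<phi> s x) (\<phi> 0 x) < r / 2"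
    unfolding eventually_at_right_field by auto
  have small: "norm (\<phi> s x - x) < r / 2" if "0 \<le> s" "s \<le> b / 2" "x \<in> cball \<zeta> (2 * r)" for s x
  proof (cases "s = 0")
    case True
    then show ?thesis using that r id[of x] by auto
  next
    case False
    then have "dist (\<phi> s x) (\<phi> 0 x) < r / 2" using b(2)[of s] False that b(1) by simp
    moreover have "\<phi> 0 x = x" using id that(3) r(2) by blast
    ultimately show ?thesis by (simp add: dist_norm)
  qed
  show ?thesis
  proof
    show "r > 0" "b / 2 > 0" using r b by auto
    show "\<phi> s \<zeta> \<in> ball \<zeta> r" if "0 \<le> s" "s \<le> b / 2" for s
      using small[OF that, of \<zeta>] r(1) by (simp add: dist_norm norm_minus_commute)
    fix s z w assume s: "0 \<le> s" "s \<le> b / 2" and zw: "z \<in> ball \<zeta> r" "w \<in> ball \<zeta> r"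
    define g where "g = (\<lambda>x. \<phi> s x - x)"
    have g: "g holomorphic_on D" unfolding g_def by (intro holomorphic_intros hol s)
    have "norm (g z - g w) \<le> 1 / 2 * norm (z - w)"
    proof (rule field_differentiable_bound[OF convex_ball _ _ zw])
      fix x assume x: "x \<in> ball \<zeta> r"
      show "(g has_field_derivative deriv g x) (at x within ball \<zeta> r)"
        using g x sub assms(1) by (meson holomorphic_derivI has_field_derivative_at_within subsetD)
      have sub': "cball x r \<subseteq> cball \<zeta> (2 * r)"
      proof
        fix y assume "y \<in> cball x r"
        then show "y \<in> cball \<zeta> (2 * r)" using x dist_triangle[of \<zeta> y x] by simp
      qed
      have "norm ((deriv ^^ 1) g x) \<le> fact 1 * (r / 2) / r ^ 1"
      proof (rule Cauchy_inequality)
        show "g holomorphic_on ball x r"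
          using g sub' r(2) ball_subset_cball by (meson holomorphic_on_subset order_trans)
        show "continuous_on (cball x r) g"
          using g sub' r(2) by (meson holomorphic_on_imp_continuous_on holomorphic_on_subset order_trans)
        show "norm (g y) \<le> r / 2" if "norm (x - y) = r" for y
          using small[OF s, of y] sub' that by (force simp: g_def dist_norm)
      qed (use r in auto)
      then show "norm (deriv g x) \<le> 1 / 2" using r(1) by simp
    qed
    then show "norm ((\<phi> s z - z) - (\<phi> s w - w)) \<le> norm (z - w) / 2" by (simp add: g_def)
  qed
qed

text \<open>The definition of a semigroup gives continuity at time zero; this supplies the rate that
  a Lipschitz estimate needs.\<close>

lemma semigroup_displacement_linear:
  assumes "open D" "holomorphic_semigroup D \<phi>" "\<zeta> \<in> D"
  obtains a B where "a > 0" "B \<ge> 0" "\<And>t. 0 \<le> t \<Longrightarrow> t \<le> a \<Longrightarrow> norm (\<phi> t \<zeta> - \<zeta>) \<le> B * t"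
proof -
  have id: "\<phi> 0 \<zeta> = \<zeta>"
    and add: "\<And>t s. 0 \<le> t \<Longrightarrow> 0 \<le> s \<Longrightarrow> \<phi> (t + s) \<zeta> = \<phi> t (\<phi> s \<zeta>)"
    using assms(2,3) by (auto simp: holomorphic_semigroup_def)
  obtain r a where r: "r > 0" and a: "a > 0"
    and mem: "\<And>s. 0 \<le> s \<Longrightarrow> s \<le> a \<Longrightarrow> \<phi> s \<zeta> \<in> ball \<zeta> r"
    and contr: "\<And>s z w. 0 \<le> s \<Longrightarrow> s \<le> a \<Longrightarrow> z \<in> ball \<zeta> r \<Longrightarrow> w \<in> ball \<zeta> r \<Longrightarrow>
       norm ((\<phi> s z - z) - (\<phi> s w - w)) \<le> norm (z - w) / 2"
    using semigroup_near_identity[OF assms] by metis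
  have "norm (\<phi> t \<zeta> - \<zeta>) \<le> 4 * r / a * t" if t: "0 \<le> t" "t \<le> a" for t
  proof (cases "t = 0")
    case True
    then show ?thesis by (simp add: id)
  next
    case False
    with t have tpos: "t > 0" by simp
    define n where "n = nat \<lfloor>a / t\<rfloor>"
    \<comment> \<open>Since \<open>a / t\<close> is at least 1, its floor \<open>n\<close> is at
      least half of it, and \<open>n\<close> steps of length \<open>t\<close> still end by time
      \<open>a\<close>.\<close>
    have "1 \<le> a / t" using tpos t by simp
    then have n1: "1 \<le> real n" and nle: "real n \<le> a / t" and nge: "a / t < real n + 1"
      by (auto simp: n_def le_nat_iff le_floor_iff)
    have nt: "real n * t \<le> a" using nle tpos by (simp add: field_simps)
    have n2: "a / t \<le> 2 * real n" using nge n1 by linarith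
    define u where "u = \<phi> t \<zeta> - \<zeta>"
    text \<open>The steps of length \<open>t\<close> all displace by roughly \<open>u\<close>, and \<open>n \<approx> a / t\<close> of them together
      displace by less than \<open>r\<close>, hence \<open>u = O(t)\<close>.\<close>
    have step: "norm (\<phi> (real (Suc k) * t) \<zeta> - \<phi> (real k * t) \<zeta> - u) \<le> norm u / 2" if "k < n" for k
    proof -
      have "real k * t \<le> real n * t" using that tpos by (intro mult_right_mono) auto
      with nt have "real k * t \<le> a" by linarith
      then have k: "0 \<le> real k * t" "real k * t \<le> a" using tpos by auto
      \<comment> \<open>With the time split in this order, step minus \<open>u\<close> is the
        difference of the displacements of \<open>\<phi> t \<zeta>\<close> and
        \<open>\<zeta>\<close> under the single map at time \<open>k t\<close>.\<close>
      have "\<phi> (real (Suc k) * t) \<zeta> = \<phi> (real k * t) (\<phi> t \<zeta>)"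
        using add[of "real k * t" t] k tpos by (simp add: algebra_simps)
      then show ?thesis
        using contr[OF k, of "\<phi> t \<zeta>" \<zeta>] mem[of t] mem[of 0] id t a r
        by (simp add: u_def algebra_simps)
    qed
    have tele: "(\<Sum>k<n. \<phi> (real (Suc k) * t) \<zeta> - \<phi> (real k * t) \<zeta>) = \<phi> (real n * t) \<zeta> - \<zeta>"
      using sum_lessThan_telescope[of "\<lambda>k. \<phi> (real k * t) \<zeta>" n] id by simp
    have "norm (\<phi> (real n * t) \<zeta> - \<zeta> - of_nat n * u)
        = norm (\<Sum>k<n. \<phi> (real (Suc k) * t) \<zeta> - \<phi> (real k * t) \<zeta> - u)"
      unfolding tele[symmetric] by (simp add: sum_subtractf)
    also have "\<dots> \<le> real n * (norm u / 2)"
      using sum_norm_bound[of "{..<n}", OF step] by simp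
    finally have "norm (of_nat n * u) \<le> norm (\<phi> (real n * t) \<zeta> - \<zeta>) + real n * (norm u / 2)"
      using norm_triangle_sub[of "of_nat n * u" "\<phi> (real n * t) \<zeta> - \<zeta>"]
      by (simp add: norm_minus_commute)
    moreover have "norm (\<phi> (real n * t) \<zeta> - \<zeta>) < r"
      using mem[of "real n * t"] nt tpos by (simp add: dist_norm norm_minus_commute)
    \<comment> \<open>The accumulated error is half of the left side and is absorbed there.\<close>
    ultimately have "real n * norm u \<le> 2 * r" by (simp add: norm_mult)
    moreover have "a / t * norm u \<le> 2 * real n * norm u" using n2 by (intro mult_right_mono) auto
    ultimately have "a / t * norm u \<le> 4 * r" by linarith
    then show ?thesis using tpos a by (simp add: u_def field_simps)
  qed
  then show ?thesis using that[of a "4 * r / a"] a r by simp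
qed

section \<open>Logarithm of the domain and Bloch's theorem\<close>

text \<open>Two values of \<open>h\<close> that differ by a period of \<open>exp\<close> would come
  from the same point of \<open>D\<close>. The radius 7 is \<open>2 * pi\<close> rounded up.\<close>

lemma log_branch_no_large_disc:
  fixes h :: "complex \<Rightarrow> complex"
  assumes "\<And>w. w \<in> D \<Longrightarrow> exp (h w) = w - p"
  shows "\<not> ball b 7 \<subseteq> h ` D"
proof
  assume *: "ball b 7 \<subseteq> h ` D"
  let ?c = "b + 2 * of_real pi * \<i>"
  have "dist b ?c = 2 * pi" by (simp add: dist_norm norm_mult)
  then have "dist b ?c < 7" using pi_approx by simp
  then have "b \<in> h ` D" "?c \<in> h ` D" using * by auto
  then obtain z w where zw: "z \<in> D" "w \<in> D" "b = h z" "?c = h w" by auto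
  have "exp ?c = exp b" by (simp add: exp_add)
  then have "z = w" using assms[of z] assms[of w] zw by simp
  then show False using zw by simp
qed

text \<open>Contrapositive of Bloch's theorem with constant 1/12. The bound depends on
  \<open>g\<close> only through the radius of the discs its image omits.\<close>

lemma Bloch_deriv_bound:
  assumes "g holomorphic_on ball x r" "r > 0" "\<And>b. \<not> ball b \<rho> \<subseteq> g ` ball x r"
  shows "norm (deriv g x) \<le> 12 * \<rho> / r"
proof (rule ccontr)
  assume "\<not> ?thesis"
  then have "\<rho> \<le> r * norm (deriv g x) / 12" using assms(2) by (simp add: field_simps)
  then show False using Bloch[OF assms(1,2)] assms(3) by metis
qed

text \<open>Mean value inequality on a half-plane, which is convex and where \<open>exp\<close>, its
  own derivative, has modulus at most \<open>exp M\<close>.\<close>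

lemma norm_exp_diff_le:
  fixes a b :: complex
  assumes "Re a \<le> M" "Re b \<le> M"
  shows "norm (exp a - exp b) \<le> exp M * norm (a - b)"
proof (rule field_differentiable_bound[where S = "{z. Re z \<le> M}" and f' = exp])
  show "convex {z. Re z \<le> M}" by (rule convex_halfspace_Re_le)
qed (use assms in \<open>auto intro: has_field_derivative_at_within DERIV_exp\<close>)

lemma orbit_log_lipschitz:
  assumes "open D" "simply_connected D" "D \<noteq> UNIV" "holomorphic_semigroup D \<phi>" "\<zeta> \<in> D"
  obtains h p a C where "\<And>w. w \<in> D \<Longrightarrow> exp (h w) = w - p" "a > 0" "C \<ge> 0"
    "\<And>t s. 0 \<le> t \<Longrightarrow> 0 \<le> s \<Longrightarrow> s \<le> a \<Longrightarrow> norm (h (\<phi> (t + s) \<zeta>) - h (\<phi> t \<zeta>)) \<le> C * s"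
proof -
  have hol: "\<And>t. 0 \<le> t \<Longrightarrow> \<phi> t holomorphic_on D" and maps: "\<And>t. 0 \<le> t \<Longrightarrow> \<phi> t ` D \<subseteq> D"
    and add: "\<And>t s. 0 \<le> t \<Longrightarrow> 0 \<le> s \<Longrightarrow> \<phi> (t + s) \<zeta> = \<phi> t (\<phi> s \<zeta>)"
    using assms(4,5) unfolding holomorphic_semigroup_def by blast+
  obtain p where p: "p \<notin> D" using assms(3) by auto
  have "(\<lambda>w. w - p) holomorphic_on D" "\<forall>w\<in>D. w - p \<noteq> 0"
    using p by (auto intro!: holomorphic_intros)
  then obtain h where h: "h holomorphic_on D" "\<forall>w\<in>D. w - p = exp (h w)"
    using assms(2) simply_connected_eq_holomorphic_log[OF assms(1)] by metis
  have log: "exp (h w) = w - p" if "w \<in> D" for w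
    using h(2) that by simp
  obtain r where r: "r > 0" and sub: "ball \<zeta> r \<subseteq> D"
    using assms(1,5) by (meson open_contains_ball)
  obtain b B where b: "b > 0" and B: "B \<ge> 0"
    and disp: "\<And>t. 0 \<le> t \<Longrightarrow> t \<le> b \<Longrightarrow> norm (\<phi> t \<zeta> - \<zeta>) \<le> B * t"
    using semigroup_displacement_linear[OF assms(1,4,5)] by blast
  define e where "e = r / 2"
  have e: "e > 0" and er: "r = e + e" using r by (auto simp: e_def)
  \<comment> \<open>Up to time \<open>c\<close> the linear bound keeps the orbit within
    \<open>e\<close> of \<open>\<zeta>\<close>; adding 1 to \<open>B\<close> covers
    \<open>B = 0\<close>.\<close>
  define c where "c = min b (e / (B + 1))"
  have c: "c > 0" using b B e by (simp add: c_def)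
  have near: "\<phi> s \<zeta> \<in> ball \<zeta> e" if "0 \<le> s" "s \<le> c" for s
  proof -
    have "norm (\<phi> s \<zeta> - \<zeta>) \<le> B * s" using disp that by (simp add: c_def)
    also have "\<dots> \<le> B * (e / (B + 1))" using that B by (intro mult_left_mono) (auto simp: c_def)
    also have "\<dots> < e" using B e by (simp add: field_simps)
    finally show ?thesis by (simp add: dist_norm norm_minus_commute)
  qed
  have "norm (h (\<phi> (t + s) \<zeta>) - h (\<phi> t \<zeta>)) \<le> 84 / e * B * s"
    if t: "0 \<le> t" and s: "0 \<le> s" "s \<le> c" for t s
  proof -
    \<comment> \<open>By the semigroup law the increment from time \<open>t\<close> to
      \<open>t + s\<close> is \<open>g (\<phi> s \<zeta>) - g \<zeta>\<close>, so a derivative bound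
      for \<open>g\<close> near \<open>\<zeta>\<close> suffices.\<close>
    define g where "g = h \<circ> \<phi> t"
    have g: "g holomorphic_on D" unfolding g_def
      by (rule holomorphic_on_compose[OF hol[OF t] holomorphic_on_subset[OF h(1) maps[OF t]]])
    have "norm (g (\<phi> s \<zeta>) - g \<zeta>) \<le> 84 / e * norm (\<phi> s \<zeta> - \<zeta>)"
    proof (rule field_differentiable_bound[where f = g and f' = "deriv g", OF convex_ball _ _ near[OF s]])
      fix x assume x: "x \<in> ball \<zeta> e"
      have subx: "ball x e \<subseteq> D"
      proof -
        have "ball x e \<subseteq> ball \<zeta> r"
        proof
          fix y assume "y \<in> ball x e"
          then show "y \<in> ball \<zeta> r" using x dist_triangle[of \<zeta> y x] by (simp add: er)
        qed
        then show ?thesis using sub by blast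
      qed
      show "(g has_field_derivative deriv g x) (at x within ball \<zeta> e)"
        using holomorphic_derivI[OF g assms(1)] subx e
        by (meson centre_in_ball has_field_derivative_at_within subsetD)
      have "g ` ball x e \<subseteq> h ` D"
        using subx maps[OF t] by (auto simp: g_def)
      then have "\<not> ball z 7 \<subseteq> g ` ball x e" for z
        using contrapos_nn[OF log_branch_no_large_disc[of D h p z, OF log] subset_trans] by simp
      then have "norm (deriv g x) \<le> 12 * 7 / e"
        by (intro Bloch_deriv_bound holomorphic_on_subset[OF g subx] e)
      then show "norm (deriv g x) \<le> 84 / e" by simp
    qed (use e in auto)
    also have "\<dots> \<le> 84 / e * (B * s)"
      using disp[of s] s e by (intro mult_left_mono) (auto simp: c_def)
    finally show ?thesis using add[OF t s(1)] by (simp add: g_def)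
  qed
  then show ?thesis using e B by (intro that[OF log c, of "84 / e * B"]) auto
qed

section \<open>Continuity of orbits and the Lipschitz bound for bounded ones\<close>

text \<open>Continuity of \<open>h\<close> along the orbit passes to the orbit itself through
  \<open>exp\<close>. It serves to bound the orbit on compact time intervals.\<close>

lemma continuous_orbit:
  assumes "open D" "simply_connected D" "D \<noteq> UNIV" "holomorphic_semigroup D \<phi>" "\<zeta> \<in> D"
  shows "continuous_on {0..} (\<lambda>t. \<phi> t \<zeta>)"
proof -
  have mem: "\<And>t. 0 \<le> t \<Longrightarrow> \<phi> t \<zeta> \<in> D"
    using assms(4,5) by (auto simp: holomorphic_semigroup_def)
  obtain h p a C where log: "\<And>w. w \<in> D \<Longrightarrow> exp (h w) = w - p" and a: "a > 0" and C: "C \<ge> 0"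
    and lip: "\<And>t s. 0 \<le> t \<Longrightarrow> 0 \<le> s \<Longrightarrow> s \<le> a \<Longrightarrow> norm (h (\<phi> (t + s) \<zeta>) - h (\<phi> t \<zeta>)) \<le> C * s"
    using orbit_log_lipschitz[OF assms] by metis
  \<comment> \<open>The earlier of the two times serves as base point, which makes the estimate
    two-sided.\<close>
  have le: "dist (h (\<phi> y \<zeta>)) (h (\<phi> x \<zeta>)) \<le> C * \<bar>y - x\<bar>"
    if "0 \<le> x" "0 \<le> y" "\<bar>y - x\<bar> \<le> a" for x y
    using lip[of x "y - x"] lip[of y "x - y"] that
    by (cases "x \<le> y") (auto simp: dist_norm norm_minus_commute)
  have "continuous_on {0..} (\<lambda>t. h (\<phi> t \<zeta>))"
    unfolding continuous_on_iff
  proof (intro ballI allI impI)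
    fix x e :: real assume x: "x \<in> {0..}" and e: "e > 0"
    define d where "d = min a (e / (C + 1))"
    have "d > 0" using a C e by (simp add: d_def)
    moreover have "dist (h (\<phi> y \<zeta>)) (h (\<phi> x \<zeta>)) < e" if y: "y \<in> {0..}" "dist y x < d" for y
    proof -
      have "dist (h (\<phi> y \<zeta>)) (h (\<phi> x \<zeta>)) \<le> C * \<bar>y - x\<bar>"
        using le x y by (simp add: d_def dist_real_def)
      also have "\<dots> \<le> C * (e / (C + 1))"
        using y C by (intro mult_left_mono) (auto simp: d_def dist_real_def)
      also have "\<dots> < e" using C e by (simp add: field_simps)
      finally show ?thesis .
    qed
    ultimately show "\<exists>d>0. \<forall>y\<in>{0..}. dist y x < d \<longrightarrow> dist (h (\<phi> y \<zeta>)) (h (\<phi> x \<zeta>)) < e" by blast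
  qed
  then have "continuous_on {0..} (\<lambda>t. p + exp (h (\<phi> t \<zeta>)))" by (intro continuous_intros)
  moreover have "p + exp (h (\<phi> t \<zeta>)) = \<phi> t \<zeta>" if "t \<in> {0..}" for t
    using log[OF mem] that by simp
  ultimately show ?thesis by (rule continuous_on_eq)
qed

text \<open>Boundedness confines \<open>h\<close> along the orbit to a half-plane bounded on the
  right, where \<open>exp\<close> is Lipschitz and carries over the estimate for
  \<open>h\<close>.\<close>

lemma bounded_orbit_lipschitz:
  assumes "open D" "simply_connected D" "D \<noteq> UNIV" "holomorphic_semigroup D \<phi>" "\<zeta> \<in> D"
    and bnd: "\<forall>\<^sub>F t in at_top. norm (\<phi> t \<zeta>) \<le> R"
  shows "lipschitz {0..} (forward_orbit \<phi> \<zeta>)"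
proof -
  have mem: "\<And>t. 0 \<le> t \<Longrightarrow> \<phi> t \<zeta> \<in> D"
    using assms(4,5) by (auto simp: holomorphic_semigroup_def)
  obtain h p a C where log: "\<And>w. w \<in> D \<Longrightarrow> exp (h w) = w - p" and a: "a > 0" and C: "C \<ge> 0"
    and lip: "\<And>t s. 0 \<le> t \<Longrightarrow> 0 \<le> s \<Longrightarrow> s \<le> a \<Longrightarrow> norm (h (\<phi> (t + s) \<zeta>) - h (\<phi> t \<zeta>)) \<le> C * s"
    using orbit_log_lipschitz[OF assms(1-5)] by metis
  obtain T where T: "\<And>t. t \<ge> T \<Longrightarrow> norm (\<phi> t \<zeta>) \<le> R"
    using bnd by (auto simp: eventually_at_top_linorder)
  have "compact ((\<lambda>t. \<phi> t \<zeta>) ` {0..T})"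
    by (intro compact_continuous_image continuous_on_subset[OF continuous_orbit[OF assms(1-5)]]) auto
  then obtain S where S: "\<And>t. 0 \<le> t \<Longrightarrow> t \<le> T \<Longrightarrow> norm (\<phi> t \<zeta>) \<le> S"
    using compact_imp_bounded by (fastforce simp: bounded_iff)
  \<comment> \<open>The absolute values guard against a negative \<open>S\<close>, possible when
    \<open>T < 0\<close> leaves no times to bound; the 1 makes \<open>ln M\<close>
    meaningful.\<close>
  define M where "M = \<bar>R\<bar> + \<bar>S\<bar> + norm p + 1"
  have M: "M > 0" using norm_ge_zero[of p] unfolding M_def by linarith
  have diff: "norm (\<phi> t \<zeta> - p) \<le> M" if "0 \<le> t" for t
  proof -
    have "norm (\<phi> t \<zeta>) \<le> \<bar>R\<bar> + \<bar>S\<bar>" using S[of t] T[of t] that by (cases "t \<le> T") auto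
    then show ?thesis using norm_triangle_ineq4[of "\<phi> t \<zeta>" p] by (simp add: M_def)
  qed
  have Re: "Re (h (\<phi> t \<zeta>)) \<le> ln M" if "0 \<le> t" for t
  proof -
    have "exp (h (\<phi> t \<zeta>)) = \<phi> t \<zeta> - p" by (rule log[OF mem[OF that]])
    then have "exp (Re (h (\<phi> t \<zeta>))) \<le> M" using diff[OF that] by (metis norm_exp_eq_Re)
    then show ?thesis using M by (simp add: ln_ge_iff)
  qed
  \<comment> \<open>The first summand serves time gaps up to \<open>a\<close>. For longer gaps two
    points of the orbit are at most \<open>2 * M\<close> apart, which is at most
    \<open>2 * M / a\<close> times the gap.\<close>
  define L where "L = M * C + 2 * M / a"
  have L: "L > 0" using M C a unfolding L_def by (intro add_nonneg_pos) auto
  have main: "norm (\<phi> (t + s) \<zeta> - \<phi> t \<zeta>) \<le> L * s" if t: "0 \<le> t" and s: "0 \<le> s" for t s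
  proof (cases "s \<le> a")
    case True
    have "\<phi> (t + s) \<zeta> - \<phi> t \<zeta> = exp (h (\<phi> (t + s) \<zeta>)) - exp (h (\<phi> t \<zeta>))"
      using log[OF mem[OF t]] log[OF mem, of "t + s"] t s by simp
    also have "norm \<dots> \<le> exp (ln M) * norm (h (\<phi> (t + s) \<zeta>) - h (\<phi> t \<zeta>))"
      using Re t s by (intro norm_exp_diff_le) auto
    also have "\<dots> \<le> M * (C * s)" using lip[OF t s True] M by (auto intro: mult_left_mono)
    also have "\<dots> \<le> L * s" using M a s by (simp add: L_def algebra_simps)
    finally show ?thesis .
  next
    case False
    have "norm (\<phi> (t + s) \<zeta> - \<phi> t \<zeta>) \<le> 2 * M"
      using diff[OF t] diff[of "t + s"] t s norm_triangle_ineq4[of "\<phi> (t + s) \<zeta> - p" "\<phi> t \<zeta> - p"]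
      by simp
    also have "\<dots> = 2 * M / a * a" using a by simp
    also have "\<dots> \<le> 2 * M / a * s" using False M a by (intro mult_left_mono) auto
    also have "\<dots> \<le> L * s" using M C s unfolding L_def by (intro mult_right_mono) auto
    finally show ?thesis .
  qed
  have "L-lipschitz_on {0..} (forward_orbit \<phi> \<zeta>)"
  proof (rule lipschitz_onI)
    fix x y :: real assume xy: "x \<in> {0..}" "y \<in> {0..}"
    show "dist (forward_orbit \<phi> \<zeta> x) (forward_orbit \<phi> \<zeta> y) \<le> L * dist x y"
      using main[of x "y - x"] main[of y "x - y"] xy
      by (cases "x \<le> y") (auto simp: forward_orbit_def dist_norm norm_minus_commute)
  qed (use L in auto)
  then show ?thesis using L by (auto simp: lipschitz_def)
qed

section \<open>Long-time behaviour of orbits and the Denjoy-Wolff point\<close>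

text \<open>Neighbourhoods of infinity are complements of compact, hence bounded, sets.\<close>

lemma limitin_riemann_sphere_None:
  assumes "filterlim (\<lambda>n. norm (x n)) at_top F"
  shows "limitin riemann_sphere (\<lambda>n. Some (x n)) None F"
  unfolding limitin_def
proof (intro conjI allI impI)
  show "None \<in> topspace riemann_sphere" by (simp add: riemann_sphere_def)
next
  fix U assume "openin riemann_sphere U \<and> None \<in> U"
  then obtain K where K: "compact K" "U = insert None (Some ` (- K))"
    by (auto simp: riemann_sphere_def openin_Alexandroff_compactification Compl_eq_Diff_UNIV)
  then obtain B where B: "\<And>y. y \<in> K \<Longrightarrow> norm y \<le> B"
    using compact_imp_bounded[OF K(1)] unfolding bounded_iff by blast
  have "\<forall>\<^sub>F n in F. B < norm (x n)" using assms by (simp add: filterlim_at_top_dense)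
  then show "\<forall>\<^sub>F n in F. Some (x n) \<in> U"
    by eventually_elim (use B K(2) in force)
qed

text \<open>The witnessing sequence is the preimage in the disc of the orbit at times when its norm
  is large; it tends to \<open>\<tau>\<close> because the whole conjugated orbit does.\<close>

lemma unbounded_orbit_impression:
  assumes "riemann_map f D" "holomorphic_semigroup D \<phi>" "\<zeta> \<in> D"
    and dw: "denjoy_wolff_point (disc_semigroup f \<phi>) \<tau>"
    and unb: "\<And>R. \<not> (\<forall>\<^sub>F t in at_top. norm (\<phi> t \<zeta>) \<le> R)"
  shows "None \<in> impression f \<tau>"
proof -
  have bij: "bij_betw f (ball 0 1) D" using assms(1) by (simp add: riemann_map_def)
  have mem: "\<And>t. 0 \<le> t \<Longrightarrow> \<phi> t \<zeta> \<in> D"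
    using assms(2,3) by (auto simp: holomorphic_semigroup_def)
  \<comment> \<open>Using \<open>n\<close> both as time threshold and as norm threshold sends the
    times and the norms to infinity together.\<close>
  have "\<exists>t\<ge>real n. norm (\<phi> t \<zeta>) > real n" for n
    using unb[of "real n"] by (auto simp: eventually_at_top_linorder not_le)
  then obtain t where t: "\<And>n. t n \<ge> real n" "\<And>n. norm (\<phi> (t n) \<zeta>) > real n" by metis
  have t0: "0 \<le> t n" for n using t(1)[of n] by linarith
  define z where "z n = inv_into (ball 0 1) f (\<phi> (t n) \<zeta>)" for n
  have fz: "f (z n) = \<phi> (t n) \<zeta>" for n
    unfolding z_def using bij_betw_inv_into_right[OF bij mem[OF t0]] .
  have zball: "range z \<subseteq> ball 0 1"
    using bij_betw_apply[OF bij_betw_inv_into[OF bij] mem[OF t0]] by (auto simp: z_def)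
  have z0: "inv_into (ball 0 1) f \<zeta> \<in> ball 0 1" and fz0: "f (inv_into (ball 0 1) f \<zeta>) = \<zeta>"
    using bij_betw_apply[OF bij_betw_inv_into[OF bij] assms(3)]
      bij_betw_inv_into_right[OF bij assms(3)] by auto
  have "((\<lambda>t. inv_into (ball 0 1) f (\<phi> t \<zeta>)) \<longlongrightarrow> \<tau>) at_top"
    using dw z0 fz0 unfolding denjoy_wolff_point_def disc_semigroup_def by metis
  moreover have "filterlim t at_top sequentially"
    using t(1) by (intro filterlim_at_top_mono[OF filterlim_real_sequentially]) auto
  ultimately have "(\<lambda>n. inv_into (ball 0 1) f (\<phi> (t n) \<zeta>)) \<longlonglongrightarrow> \<tau>"
    by (rule filterlim_compose)
  then have "z \<longlonglongrightarrow> \<tau>" by (simp add: z_def[abs_def])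
  moreover have "filterlim (\<lambda>n. norm (f (z n))) at_top sequentially"
    unfolding fz
    by (intro filterlim_at_top_mono[OF filterlim_real_sequentially] always_eventually allI)
       (rule less_imp_le[OF t(2)])
  ultimately show ?thesis
    unfolding impression_def using zball limitin_riemann_sphere_None[of "\<lambda>n. f (z n)"]
    by (intro CollectI exI[of _ z] conjI) simp_all
qed

text \<open>Continuity of \<open>f\<close> at the interior point \<open>\<tau>\<close> makes the
  orbit converge to \<open>f \<tau>\<close>.\<close>

lemma interior_denjoy_wolff_orbit_bounded:
  assumes "riemann_map f D" "holomorphic_semigroup D \<phi>" "\<zeta> \<in> D"
    and dw: "denjoy_wolff_point (disc_semigroup f \<phi>) \<tau>" "\<tau> \<in> ball 0 1"
  shows "\<forall>\<^sub>F t in at_top. norm (\<phi> t \<zeta>) \<le> norm (f \<tau>) + 1"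
proof -
  have bij: "bij_betw f (ball 0 1) D" and hol: "f holomorphic_on ball 0 1"
    using assms(1) by (auto simp: riemann_map_def)
  have mem: "\<And>t. 0 \<le> t \<Longrightarrow> \<phi> t \<zeta> \<in> D"
    using assms(2,3) by (auto simp: holomorphic_semigroup_def)
  have z0: "inv_into (ball 0 1) f \<zeta> \<in> ball 0 1" and fz0: "f (inv_into (ball 0 1) f \<zeta>) = \<zeta>"
    using bij_betw_apply[OF bij_betw_inv_into[OF bij] assms(3)]
      bij_betw_inv_into_right[OF bij assms(3)] by auto
  have "((\<lambda>t. inv_into (ball 0 1) f (\<phi> t \<zeta>)) \<longlongrightarrow> \<tau>) at_top"
    using dw(1) z0 fz0 unfolding denjoy_wolff_point_def disc_semigroup_def by metis
  moreover have "isCont f \<tau>"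
    using hol dw(2) holomorphic_on_imp_continuous_on continuous_on_interior by fastforce
  ultimately have "((\<lambda>t. f (inv_into (ball 0 1) f (\<phi> t \<zeta>))) \<longlongrightarrow> f \<tau>) at_top"
    by (rule isCont_tendsto_compose[rotated])
  then have "\<forall>\<^sub>F t in at_top. dist (f (inv_into (ball 0 1) f (\<phi> t \<zeta>))) (f \<tau>) < 1"
    by (auto simp: tendsto_iff)
  \<comment> \<open>For nonnegative times the orbit lies in \<open>D\<close>, where \<open>f\<close>
    undoes \<open>inv_into\<close>.\<close>
  then show ?thesis using eventually_ge_at_top[of 0]
  proof eventually_elim
    case (elim t)
    then have "norm (\<phi> t \<zeta> - f \<tau>) < 1"
      using bij_betw_inv_into_right[OF bij mem] by (simp add: dist_norm)
    then show ?case using norm_triangle_sub[of "\<phi> t \<zeta>" "f \<tau>"] by simp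
  qed
qed

section \<open>The elliptic and the non-elliptic case\<close>

theorem proposition6p2:
  fixes D :: "complex set" and \<phi> :: "real \<Rightarrow> complex \<Rightarrow> complex" and f :: "complex \<Rightarrow> complex"
  assumes "open D" and "simply_connected D" and "D \<noteq> {}" and "D \<noteq> UNIV"
    and "holomorphic_semigroup D \<phi>"
    and "riemann_map f D"
  shows "(elliptic f \<phi> \<longrightarrow> (\<forall>\<zeta>\<in>D. lipschitz {0..} (forward_orbit \<phi> \<zeta>))) \<and>
         (non_elliptic f \<phi> \<and> None \<notin> denjoy_wolff_impression f \<phi> \<longrightarrow>
           (\<forall>\<zeta>\<in>D. lipschitz {0..} (forward_orbit \<phi> \<zeta>)))"
proof (intro conjI impI ballI)
  fix \<zeta> assume "elliptic f \<phi>" and \<zeta>: "\<zeta> \<in> D"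
  then obtain \<tau> where "denjoy_wolff_point (disc_semigroup f \<phi>) \<tau>" "\<tau> \<in> ball 0 1"
    by (auto simp: elliptic_def)
  then have "\<forall>\<^sub>F t in at_top. norm (\<phi> t \<zeta>) \<le> norm (f \<tau>) + 1"
    by (rule interior_denjoy_wolff_orbit_bounded[OF assms(6,5) \<zeta>])
  then show "lipschitz {0..} (forward_orbit \<phi> \<zeta>)"
    by (rule bounded_orbit_lipschitz[OF assms(1,2,4,5) \<zeta>])
next
  fix \<zeta> assume ne: "non_elliptic f \<phi> \<and> None \<notin> denjoy_wolff_impression f \<phi>" and \<zeta>: "\<zeta> \<in> D"
  then obtain \<tau> where \<tau>: "\<tau> \<in> sphere 0 1" "denjoy_wolff_point (disc_semigroup f \<phi>) \<tau>"
    by (auto simp: non_elliptic_def)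
  then have "None \<notin> impression f \<tau>" using ne by (auto simp: denjoy_wolff_impression_def)
  then obtain R where "\<forall>\<^sub>F t in at_top. norm (\<phi> t \<zeta>) \<le> R"
    using unbounded_orbit_impression[OF assms(6,5) \<zeta> \<tau>(2)] by blast
  then show "lipschitz {0..} (forward_orbit \<phi> \<zeta>)"
    by (rule bounded_orbit_lipschitz[OF assms(1,2,4,5) \<zeta>])
qed

end
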